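(* For integers $m\ge 1$ and $n\ge 1$ define the Hoggatt polynomial \[ H_n^{[m]}(1,t)=\sum_{k=0}^{n-1}\frac{\prod_{i=0}^{m-1}\binom{n+m-2}{k+i}}{\prod_{j=1}^{m-1}\binom{n+m-2}{j}}\,t^k \] (empty products equal $1$). Then: for $m=1$ the sequence $\{H_n^{[1]}(1,t)\}_{n\ge 1}$ is a generalized Sturm sequence; and for every integer $m\ge 2$ the sequence $\{H_n^{[m]}(1,t)\}_{n\ge 1}$ is a Sturm sequence.
   Context: For real polynomials $f,g$ with only real zeros, let $u_1\ge u_2\ge\cdots$ be the zeros of $f$ and $v_1\ge v_2\ge\cdots$ the zeros of $g$, listed with multiplicity in weakly decreasing order. $g$ interlaces $f$ if $\deg f=\deg g+1=n$ and $u_n\le v_{n-1}\le u_{n-1}\le\cdots\le v_1\le u_1$; $g$ alternates left of $f$ if $\deg f=\deg g=n$ and $v_n\le u_n\le v_{n-1}\le u_{n-1}\le\cdots\le v_1\le u_1$. Write $g\preceq f$ if $g$ interlaces or alternates left of $f$; by convention also $a\preceq bx+c$ for any nonnegative reals $a,b,c$, and $f\preceq 0$, $0\preceq f$ for any real-rooted $f$. "Strictly interlaces" / "strictly alternates left of" mean that all inequalities above are strict, and $g\prec f$ means $g$ strictly interlaces or strictly alternates left of $f$. A sequence of real-rooted polynomials $\{f_n\}$ is a Sturm sequence if $f_n\prec f_{n+1}$ for all consecutive indices, and a generalized Sturm sequence if $f_n\preceq f_{n+1}$ for all consecutive indices. *)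

theory Defs
  imports Complex_Main "HOL-Computational_Algebra.Computational_Algebra"
begin

text \<open>
  The zero polynomial counts as real-rooted, so that the convention
  \<open>f \<preceq> 0\<close> is compatible with sequences of real-rooted polynomials.
\<close>

definition real_rooted :: "real poly \<Rightarrow> bool" where
  "real_rooted f \<longleftrightarrow>
     f = 0 \<or> (\<forall>z::complex. poly (map_poly complex_of_real f) z = 0 \<longrightarrow> z \<in> \<real>)"

text \<open>
  The real zeros with multiplicity, in weakly decreasing order. Lists are indexed from 0,
  so \<open>zeros_desc f ! i\<close> is \<open>u\<^sub>i\<^sub>+\<^sub>1\<close>; the list has length \<open>degree f\<close>
  exactly when the nonzero polynomial \<open>f\<close> is real-rooted.
\<close>

definition zeros_desc :: "real poly \<Rightarrow> real list" where
  "zeros_desc f = rev (sorted_list_of_multiset (proots f))"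

text \<open>
  The order \<open>R\<close> is \<open>(\<le>)\<close> for the weak and \<open>(<)\<close> for the strict notions.
  Polynomials are required to be nonzero: \<open>degree 0 = 0\<close> in the library,
  so the zero polynomial would otherwise satisfy these conditions vacuously.
\<close>

definition interlaces_wrt :: "(real \<Rightarrow> real \<Rightarrow> bool) \<Rightarrow> real poly \<Rightarrow> real poly \<Rightarrow> bool" where
  "interlaces_wrt R g f \<longleftrightarrow>
     g \<noteq> 0 \<and> f \<noteq> 0 \<and> real_rooted g \<and> real_rooted f \<and> degree f = degree g + 1 \<and>
     (\<forall>i < degree g. R (zeros_desc f ! (i + 1)) (zeros_desc g ! i) \<and>
                     R (zeros_desc g ! i) (zeros_desc f ! i))"

definition alternates_left_wrt :: "(real \<Rightarrow> real \<Rightarrow> bool) \<Rightarrow> real poly \<Rightarrow> real poly \<Rightarrow> bool" where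
  "alternates_left_wrt R g f \<longleftrightarrow>
     g \<noteq> 0 \<and> f \<noteq> 0 \<and> real_rooted g \<and> real_rooted f \<and> degree f = degree g \<and>
     (\<forall>i < degree f. R (zeros_desc g ! i) (zeros_desc f ! i)) \<and>
     (\<forall>i. i + 1 < degree f \<longrightarrow> R (zeros_desc f ! (i + 1)) (zeros_desc g ! i))"

abbreviation "interlaces \<equiv> interlaces_wrt (\<le>)"
abbreviation "strictly_interlaces \<equiv> interlaces_wrt (<)"
abbreviation "alternates_left \<equiv> alternates_left_wrt (\<le>)"
abbreviation "strictly_alternates_left \<equiv> alternates_left_wrt (<)"

definition poly_preceq :: "real poly \<Rightarrow> real poly \<Rightarrow> bool" (infix "\<preceq>" 50) where
  "g \<preceq> f \<longleftrightarrow>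
     interlaces g f \<or> alternates_left g f \<or>
     (\<exists>a b c. 0 \<le> a \<and> 0 \<le> b \<and> 0 \<le> c \<and> g = [:a:] \<and> f = [:c, b:]) \<or>
     (real_rooted g \<and> f = 0) \<or> (g = 0 \<and> real_rooted f)"

definition poly_prec :: "real poly \<Rightarrow> real poly \<Rightarrow> bool" (infix "\<prec>" 50) where
  "g \<prec> f \<longleftrightarrow> strictly_interlaces g f \<or> strictly_alternates_left g f"

text \<open>Sequences are indexed by a set \<open>I\<close> of consecutive natural numbers.\<close>

definition sturm_sequence :: "nat set \<Rightarrow> (nat \<Rightarrow> real poly) \<Rightarrow> bool" where
  "sturm_sequence I f \<longleftrightarrow>
     (\<forall>n\<in>I. real_rooted (f n)) \<and> (\<forall>n. n \<in> I \<and> Suc n \<in> I \<longrightarrow> f n \<prec> f (Suc n))"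

definition generalized_sturm_sequence :: "nat set \<Rightarrow> (nat \<Rightarrow> real poly) \<Rightarrow> bool" where
  "generalized_sturm_sequence I f \<longleftrightarrow>
     (\<forall>n\<in>I. real_rooted (f n)) \<and> (\<forall>n. n \<in> I \<and> Suc n \<in> I \<longrightarrow> f n \<preceq> f (Suc n))"

text \<open>
  \<open>H\<^sub>n\<^sup>[\<^sup>m\<^sup>](1,t)\<close> as a polynomial in \<open>t\<close>. Meant for \<open>m \<ge> 1\<close> and
  \<open>n \<ge> 1\<close>, where the natural-number subtractions do not truncate.
\<close>

definition hoggatt :: "nat \<Rightarrow> nat \<Rightarrow> real poly" where
  "hoggatt m n =
     (\<Sum>k=0..n-1. monom ((\<Prod>i=0..m-1. real ((n + m - 2) choose (k + i))) /
                          (\<Prod>j=1..m-1. real ((n + m - 2) choose j))) k)"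

end

theory Submission
  imports Defs
begin

text \<open>
  Put \<open>a\<^sub>m(k) = 1/(k! (k+1)! \<dots> (k+m-1)!)\<close>. Up to a positive factor,
  \<open>H\<^sub>d\<^sub>+\<^sub>1\<^sup>[\<^sup>m\<^sup>](1,t)\<close> is the \<open>d\<close>-th convolution polynomial
  \<open>\<Sum>\<^sub>k a\<^sub>m(k) a\<^sub>m(d-k) t\<^sup>k\<close>, so passing from \<open>m\<close> to \<open>m+1\<close> applies the
  multiplier \<open>1/(k+m)!\<close> once to the coefficients and once to the reversed coefficients.
  This multiplier turns real-rooted polynomials into real-rooted polynomials with simple zeros, because
  multiplying by \<open>t - u\<close> on one side corresponds to applying \<open>1 - u d/dt\<close> on the other.
  It therefore acts on all linear combinations \<open>\<alpha> f + \<beta> g\<close> of two consecutive polynomials at once.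
  If all of these are real-rooted with simple zeros, the Wronskian of \<open>f\<close> and \<open>g\<close> has no
  real zero, so \<open>g/f\<close> has a partial fraction expansion with positive residues. This expansion gives
  strict interlacing, and for negative zeros it also shows that all \<open>\<alpha> f + \<beta> t g\<close> are
  real-rooted, which is what the multiplier on the reversed side needs. The recursion starts at
  \<open>m = 1\<close> with the powers of \<open>1 + t\<close>.
\<close>

subsection \<open>Real-rooted polynomials\<close>


abbreviation cpoly :: "real poly \<Rightarrow> complex \<Rightarrow> complex" where
  "cpoly f z \<equiv> poly (map_poly complex_of_real f) z"

lemma cpoly_of_real: "cpoly f (complex_of_real x) = complex_of_real (poly f x)"
  by (induction f) (simp_all add: map_poly_pCons)

lemma cpoly_add: "cpoly (f + g) z = cpoly f z + cpoly g z"
proof -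
  have "map_poly complex_of_real (f + g) = map_poly complex_of_real f + map_poly complex_of_real g"
    by (rule poly_eqI) (simp add: coeff_map_poly)
  then show ?thesis by simp
qed

lemma cpoly_smult: "cpoly (smult c f) z = complex_of_real c * cpoly f z"
  by (simp add: map_poly_smult)

lemma cpoly_pCons: "cpoly (pCons c f) z = complex_of_real c + z * cpoly f z"
  by (simp add: map_poly_pCons)

lemma cpoly_mult: "cpoly (f * g) z = cpoly f z * cpoly g z"
  by (induction f) (simp_all add: cpoly_add cpoly_smult cpoly_pCons mult_pCons_left algebra_simps)

lemma cpoly_diff: "cpoly (f - g) z = cpoly f z - cpoly g z"
  using cpoly_add[of "f - g" g z] by simp

lemma cpoly_prod: "cpoly (\<Prod>i\<in>A. f i) z = (\<Prod>i\<in>A. cpoly (f i) z)"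
  by (induction A rule: infinite_finite_induct) (simp_all add: cpoly_mult)

lemma cpoly_sum: "cpoly (\<Sum>i\<in>A. f i) z = (\<Sum>i\<in>A. cpoly (f i) z)"
  by (induction A rule: infinite_finite_induct) (simp_all add: cpoly_add)

declare mult_pCons_left [simp del] mult_pCons_right [simp del]

lemmas cpoly_simps = cpoly_of_real cpoly_add cpoly_smult cpoly_pCons cpoly_mult cpoly_diff
  cpoly_prod cpoly_sum

lemma cpoly_prod_mset_eq_0_iff:
  "cpoly (\<Prod>u\<in>#A. [:- u, 1:]) z = 0 \<longleftrightarrow> (\<exists>u\<in>#A. z = complex_of_real u)"
  by (induction A) (auto simp: cpoly_mult cpoly_pCons)

lemma real_rooted_iff_Im:
  "f \<noteq> 0 \<Longrightarrow> real_rooted f \<longleftrightarrow> (\<forall>z. Im z \<noteq> 0 \<longrightarrow> cpoly f z \<noteq> 0)"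
  by (auto simp: real_rooted_def complex_is_Real_iff)

lemma real_rooted_prod_mset:
  "real_rooted (smult c (\<Prod>u\<in>#A. [:- u, 1:]))"
  by (auto simp: real_rooted_def cpoly_smult cpoly_prod_mset_eq_0_iff)

text \<open>Algebraic closedness supplies a complex zero, which is real by hypothesis; its linear
  factor is split off and the cofactor is again real-rooted.\<close>

lemma real_rooted_splits:
  assumes "f \<noteq> 0" "real_rooted f"
  obtains A where "f = smult (lead_coeff f) (\<Prod>u\<in>#A. [:- u, 1:])"
proof -
  have "\<exists>A. f = smult (lead_coeff f) (\<Prod>u\<in>#A. [:- u, 1:])"
    using assms
  proof (induction "degree f" arbitrary: f)
    case 0
    then obtain c where "f = [:c:]" by (auto elim: degree_eq_zeroE)
    then show ?case by (intro exI[of _ "{#}"]) simp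
  next
    case (Suc n)
    have "degree (map_poly complex_of_real f) > 0"
      using Suc.hyps by (simp add: degree_map_poly)
    then obtain z where z: "cpoly f z = 0" using alg_closed_imp_poly_has_root by blast
    with Suc.prems have "z \<in> \<real>" by (auto simp: real_rooted_def)
    then obtain u where "z = complex_of_real u" by (auto elim: Reals_cases)
    with z have "poly f u = 0" by (simp add: cpoly_of_real)
    then obtain g where g: "f = [:- u, 1:] * g" by (auto simp: poly_eq_0_iff_dvd elim: dvdE)
    with Suc.prems have "g \<noteq> 0" by auto
    have "degree f = degree [:- u, 1:] + degree g"
      unfolding g using \<open>g \<noteq> 0\<close> by (subst degree_mult_eq) auto
    then have "n = degree g" using Suc.hyps by simp
    moreover have "real_rooted g"
      using Suc.prems unfolding g real_rooted_def by (auto simp: cpoly_mult)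
    ultimately obtain A where "g = smult (lead_coeff g) (\<Prod>u\<in>#A. [:- u, 1:])"
      using Suc.hyps(1) \<open>g \<noteq> 0\<close> by blast
    moreover have "lead_coeff f = lead_coeff g"
      unfolding g by (subst lead_coeff_mult) simp
    ultimately have A: "g = smult (lead_coeff f) (\<Prod>u\<in>#A. [:- u, 1:])" by metis
    have step: "[:- u, 1:] * smult c (\<Prod>u\<in>#A. [:- u, 1:]) =
        smult c (\<Prod>u\<in>#add_mset u A. [:- u, 1:])" for c by simp
    have "f = [:- u, 1:] * smult (lead_coeff f) (\<Prod>u\<in>#A. [:- u, 1:])"
      using g unfolding A[symmetric] .
    then have "f = smult (lead_coeff f) (\<Prod>u\<in>#add_mset u A. [:- u, 1:])"
      unfolding step .
    then show ?case by blast
  qed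
  then show ?thesis using that by blast
qed

text \<open>The logarithmic derivative at \<open>z\<close> is the sum of \<open>1/(z - u)\<close>,
  and each summand has imaginary part of sign opposite to \<open>Im z\<close>. Multiplying by the
  squared modulus of the polynomial avoids the quotient and leaves an induction over the
  factors.\<close>

lemma Im_pderiv_cnj:
  assumes "Im z \<noteq> 0" "A \<noteq> {#}"
  shows "Im z * Im (cpoly (pderiv (\<Prod>u\<in>#A. [:- u, 1:])) z * cnj (cpoly (\<Prod>u\<in>#A. [:- u, 1:]) z)) < 0"
  using assms(2)
proof (induction A)
  case empty
  then show ?case by simp
next
  case (add a A)
  define p where "p = (\<Prod>u\<in>#A. [:- u, 1:])"
  define q where "q = (\<Prod>u\<in>#add_mset a A. [:- u, 1:])"
  have q: "q = [:- a, 1:] * p" by (simp add: p_def q_def)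
  have dq: "pderiv q = p + [:- a, 1:] * pderiv p"
    unfolding q by (simp only: pderiv_mult) (simp add: pderiv_pCons algebra_simps)
  have "cpoly p z \<noteq> 0"
    using assms(1) by (auto simp: p_def cpoly_prod_mset_eq_0_iff)
  then have neg: "- ((Im z)\<^sup>2 * (cmod (cpoly p z))\<^sup>2) < 0"
    using assms(1) by simp
  have Im_lin: "Im (complex_of_real k * cnj w + complex_of_real l * v) = - (k * Im w) + l * Im v" for k l w v
    by simp
  have cn: "cpoly p z * cnj (cpoly p z) = complex_of_real ((cmod (cpoly p z))\<^sup>2)"
    "(z - a) * cnj (z - a) = complex_of_real ((cmod (z - a))\<^sup>2)"
    by (simp_all only: complex_norm_square)
  have "cpoly (pderiv q) z * cnj (cpoly q z) =
     (cpoly p z * cnj (cpoly p z)) * cnj (z - a) +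
     ((z - a) * cnj (z - a)) * (cpoly (pderiv p) z * cnj (cpoly p z))"
    unfolding dq unfolding q by (simp add: cpoly_simps algebra_simps)
  then have E: "Im (cpoly (pderiv q) z * cnj (cpoly q z)) =
     - ((cmod (cpoly p z))\<^sup>2 * Im z) +
     (cmod (z - a))\<^sup>2 * Im (cpoly (pderiv p) z * cnj (cpoly p z))"
    unfolding cn by (simp only: Im_lin) simp
  have eq: "Im z * Im (cpoly (pderiv q) z * cnj (cpoly q z)) =
     - ((Im z)\<^sup>2 * (cmod (cpoly p z))\<^sup>2) +
     (cmod (z - a))\<^sup>2 * (Im z * Im (cpoly (pderiv p) z * cnj (cpoly p z)))"
    unfolding E by (simp add: power2_eq_square right_diff_distrib mult_ac del: times_complex.sel)
  \<comment> \<open>The strict induction hypothesis is available only for nonempty \<open>A\<close>;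
    for empty \<open>A\<close> the derivative vanishes, so the weak bound covers both cases.\<close>
  have "Im z * Im (cpoly (pderiv p) z * cnj (cpoly p z)) \<le> 0"
  proof (cases "A = {#}")
    case True
    then show ?thesis by (simp add: p_def)
  next
    case False
    then show ?thesis using add.IH unfolding p_def by simp
  qed
  then have "(cmod (z - a))\<^sup>2 * (Im z * Im (cpoly (pderiv p) z * cnj (cpoly p z))) \<le> 0"
    by (rule mult_nonneg_nonpos[OF zero_le_power2])
  with eq neg show ?case unfolding q_def by linarith
qed

text \<open>The derivative of \<open>p'/p\<close> is the negative sum of \<open>1/(x - u)^2\<close>;
  the inequality is this negativity multiplied by \<open>p(x)^2\<close>, again proved factor by
  factor.\<close>

lemma laguerre_inequality:
  fixes A :: "real multiset"
  defines "p \<equiv> (\<Prod>u\<in>#A. [:- u, 1:])"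
  assumes "A \<noteq> {#}" "poly p x \<noteq> 0"
  shows "poly p x * poly (pderiv (pderiv p)) x < (poly (pderiv p) x)\<^sup>2"
  using assms(2,3) unfolding p_def
proof (induction A)
  case empty
  then show ?case by simp
next
  case (add a A)
  define p where "p = (\<Prod>u\<in>#A. [:- u, 1:])"
  define q where "q = (\<Prod>u\<in>#add_mset a A. [:- u, 1:])"
  have q: "q = [:- a, 1:] * p" by (simp add: p_def q_def)
  have dq: "pderiv q = p + [:- a, 1:] * pderiv p"
    unfolding q by (simp only: pderiv_mult) (simp add: pderiv_pCons algebra_simps)
  have ddq: "pderiv (pderiv q) = 2 * pderiv p + [:- a, 1:] * pderiv (pderiv p)"
    unfolding dq by (simp only: pderiv_mult pderiv_add) (simp add: pderiv_pCons algebra_simps)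
  have nz: "poly p x \<noteq> 0" using add.prems by (simp add: p_def)
  have "poly p x * poly (pderiv (pderiv p)) x \<le> (poly (pderiv p) x)\<^sup>2"
  proof (cases "A = {#}")
    case True
    then show ?thesis by (simp add: p_def)
  next
    case False
    then show ?thesis using add.IH nz unfolding p_def by simp
  qed
  then have "(x - a)\<^sup>2 * (poly p x * poly (pderiv (pderiv p)) x) \<le> (x - a)\<^sup>2 * (poly (pderiv p) x)\<^sup>2"
    by (intro mult_left_mono) auto
  moreover have "(poly p x)\<^sup>2 > 0" using nz by simp
  moreover have "(poly (pderiv q) x)\<^sup>2 - poly q x * poly (pderiv (pderiv q)) x =
     (poly p x)\<^sup>2 + ((x - a)\<^sup>2 * (poly (pderiv p) x)\<^sup>2 - (x - a)\<^sup>2 * (poly p x * poly (pderiv (pderiv p)) x))"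
    unfolding ddq unfolding dq unfolding q by (simp add: power2_eq_square algebra_simps)
  ultimately show ?case unfolding q_def by linarith
qed

text \<open>The origin is exempt from simplicity because the polynomials treated below carry a
  factor \<open>monom 1 i\<close>.\<close>

definition simple_nonzero_rooted :: "real poly \<Rightarrow> bool" where
  "simple_nonzero_rooted p \<longleftrightarrow> p \<noteq> 0 \<and> real_rooted p \<and>
     (\<forall>x. x \<noteq> 0 \<longrightarrow> poly p x = 0 \<longrightarrow> poly (pderiv p) x \<noteq> 0)"

text \<open>A nonreal zero of \<open>p - r p'\<close> would make \<open>p' * cnj p\<close> real
  there, against \<open>Im_pderiv_cnj\<close>. A multiple zero \<open>x \<noteq> 0\<close> with
  \<open>p(x) \<noteq> 0\<close> would force \<open>p p'' = p'^2\<close>, against the Laguerre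
  inequality; with \<open>p(x) = 0\<close> it would give \<open>p'(x) = 0\<close>, against
  simplicity of \<open>p\<close>.\<close>

lemma simple_nonzero_rooted_diff_pderiv:
  assumes "simple_nonzero_rooted p"
  shows "simple_nonzero_rooted (p - smult r (pderiv p))"
proof (cases "degree p = 0 \<or> r = 0")
  case True
  then have "p - smult r (pderiv p) = p" using pderiv_eq_0_iff[of p] by auto
  then show ?thesis using assms by argo
next
  case False
  then have r: "r \<noteq> 0" by simp
  define q where "q = p - smult r (pderiv p)"
  have p: "p \<noteq> 0" "real_rooted p"
    and simple: "\<And>x. x \<noteq> 0 \<Longrightarrow> poly p x = 0 \<Longrightarrow> poly (pderiv p) x \<noteq> 0"
    using assms by (auto simp: simple_nonzero_rooted_def)
  obtain A where A: "p = smult (lead_coeff p) (\<Prod>u\<in>#A. [:- u, 1:])"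
    using real_rooted_splits[OF p] .
  define c where "c = lead_coeff p"
  define P where "P = (\<Prod>u\<in>#A. [:- u, 1:])"
  have pP: "p = smult c P" using A by (simp add: c_def P_def)
  have c: "c \<noteq> 0" using p by (simp add: c_def)
  have "A \<noteq> {#}"
  proof
    assume "A = {#}"
    then have "p = [:c:]" using pP by (simp add: P_def)
    then show False using False by simp
  qed
  have nonreal: "cpoly q z \<noteq> 0" if z: "Im z \<noteq> 0" for z
  proof
    assume "cpoly q z = 0"
    then have "cpoly P z = r * cpoly (pderiv P) z"
      using c by (simp add: q_def pP cpoly_simps pderiv_smult)
    then have "cpoly (pderiv P) z * cnj (cpoly P z) =
        complex_of_real r * complex_of_real ((cmod (cpoly (pderiv P) z))\<^sup>2)"
      unfolding complex_norm_square by simp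
    then have "Im (cpoly (pderiv P) z * cnj (cpoly P z)) = 0"
      by (simp del: of_real_power)
    then show False
      using Im_pderiv_cnj[OF z \<open>A \<noteq> {#}\<close>] unfolding P_def by simp
  qed
  then have "cpoly q \<i> \<noteq> 0" by simp
  then have q0: "q \<noteq> 0" by auto
  have "poly (pderiv q) x \<noteq> 0" if x: "x \<noteq> 0" "poly q x = 0" for x
  proof (cases "poly p x = 0")
    case True
    then show ?thesis using simple[OF x(1)] x(2) r by (simp add: q_def)
  next
    case False
    then have "poly P x \<noteq> 0" using pP by auto
    then have L: "poly P x * poly (pderiv (pderiv P)) x < (poly (pderiv P) x)\<^sup>2"
      using laguerre_inequality[OF \<open>A \<noteq> {#}\<close>] unfolding P_def by simp
    have e: "poly P x = r * poly (pderiv P) x"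
      using x(2) c by (simp add: q_def pP pderiv_smult)
    show ?thesis
    proof
      assume "poly (pderiv q) x = 0"
      then have e2: "poly (pderiv P) x = r * poly (pderiv (pderiv P)) x"
        using c by (simp add: q_def pP pderiv_smult pderiv_diff)
      have "poly P x * poly (pderiv (pderiv P)) x = poly (pderiv P) x * (r * poly (pderiv (pderiv P)) x)"
        unfolding e by simp
      with L show False unfolding e2[symmetric] by (simp add: power2_eq_square)
    qed
  qed
  then show ?thesis
    using q0 nonreal by (auto simp: simple_nonzero_rooted_def real_rooted_iff_Im q_def)
qed

subsection \<open>The multiplier 1/(k+i)!\<close>


definition simple_rooted :: "real poly \<Rightarrow> bool" where
  "simple_rooted p \<longleftrightarrow> p \<noteq> 0 \<and> real_rooted p \<and>
     (\<forall>x. poly p x = 0 \<longrightarrow> poly (pderiv p) x \<noteq> 0)"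

text \<open>Applied to \<open>[:1, -1:] ^ n\<close>, this gives a positive multiple of the
  generalized Laguerre polynomial of degree \<open>n\<close> with parameter
  \<open>i\<close>.\<close>

definition laguerre :: "nat \<Rightarrow> real poly \<Rightarrow> real poly" where
  "laguerre i h = (\<Sum>k\<le>degree h. monom (coeff h k / fact (k + i)) k)"

lemma coeff_laguerre [simp]: "coeff (laguerre i h) k = coeff h k / fact (k + i)"
  by (cases "k \<le> degree h") (simp_all add: laguerre_def coeff_sum coeff_eq_0 if_distrib cong: if_cong)

lemma laguerre_diff: "laguerre i (f - g) = laguerre i f - laguerre i g"
  by (rule poly_eqI) (simp add: diff_divide_distrib)

lemma laguerre_add: "laguerre i (f + g) = laguerre i f + laguerre i g"
  by (rule poly_eqI) (simp add: add_divide_distrib)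

lemma laguerre_smult: "laguerre i (smult c f) = smult c (laguerre i f)"
  by (rule poly_eqI) simp

text \<open>Differentiation lowers \<open>t^(k+i+1)/(k+i+1)!\<close> to
  \<open>t^(k+i)/(k+i)!\<close>, so it undoes a multiplication by \<open>t\<close> made before the
  multiplier. The factor \<open>monom 1 i\<close> aligns exponents with factorials.\<close>

lemma monom_laguerre_pderiv:
  "monom 1 i * laguerre i h = pderiv (monom 1 i * laguerre i (pCons 0 h))"
proof (rule poly_eqI)
  fix n
  show "coeff (monom 1 i * laguerre i h) n = coeff (pderiv (monom 1 i * laguerre i (pCons 0 h))) n"
  proof (cases "n < i")
    case True
    \<comment> \<open>At \<open>Suc n = i\<close> the derivative sees the constant coefficient of
      \<open>pCons 0 h\<close>, which is 0.\<close>
    then show ?thesis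
      by (cases "Suc n = i") (auto simp: coeff_monom_mult coeff_pderiv)
  next
    case False
    then have "Suc n - i = Suc (n - i)" by simp
    then show ?thesis using False
      by (simp add: coeff_monom_mult coeff_pderiv)
  qed
qed

lemma simple_nonzero_rooted_monom:
  assumes "c \<noteq> 0"
  shows "simple_nonzero_rooted (monom c n)"
  unfolding simple_nonzero_rooted_def real_rooted_def
  using assms by (auto simp: map_poly_monom poly_monom)

text \<open>A factor \<open>t - u\<close> in front of the multiplier becomes the operator
  \<open>1 - u d/dt\<close> behind it, applied to the image of the same product with a factor
  \<open>t\<close> instead. The exponent \<open>s\<close> counts these extra factors, hence the
  induction with \<open>s\<close> arbitrary.\<close>

lemma simple_nonzero_rooted_laguerre_prod:
  "simple_nonzero_rooted (monom 1 i * laguerre i (monom 1 s * (\<Prod>u\<in>#A. [:- u, 1:])))"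
proof (induction A arbitrary: s)
  case empty
  have "monom 1 i * laguerre i (monom 1 s) = monom (1 / fact (s + i)) (s + i)"
    by (rule poly_eqI) (auto simp: coeff_monom_mult)
  then show ?case by (simp add: simple_nonzero_rooted_monom)
next
  case (add u A)
  define h where "h = monom 1 s * (\<Prod>u\<in>#A. [:- u, 1:])"
  define F where "F = monom 1 i * laguerre i (pCons 0 h)"
  have h0: "pCons 0 h = monom 1 (Suc s) * (\<Prod>u\<in>#A. [:- u, 1:])"
    by (simp add: h_def monom_Suc mult_pCons_left)
  have "monom 1 s * (\<Prod>u\<in>#add_mset u A. [:- u, 1:]) = pCons 0 h - smult u h"
    by (simp add: h_def mult_pCons_left mult_pCons_right right_diff_distrib)
  then have "monom 1 i * laguerre i (monom 1 s * (\<Prod>u\<in>#add_mset u A. [:- u, 1:])) =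
      F - smult u (monom 1 i * laguerre i h)"
    by (simp add: laguerre_diff laguerre_smult F_def right_diff_distrib)
  also have "monom 1 i * laguerre i h = pderiv F"
    unfolding F_def by (rule monom_laguerre_pderiv)
  finally show ?case
    using simple_nonzero_rooted_diff_pderiv add.IH[of "Suc s"] unfolding F_def h0 by metis
qed

lemma simple_nonzero_rooted_smult:
  "c \<noteq> 0 \<Longrightarrow> simple_nonzero_rooted p \<Longrightarrow> simple_nonzero_rooted (smult c p)"
  by (auto simp: simple_nonzero_rooted_def real_rooted_def cpoly_smult pderiv_smult)

text \<open>Away from the origin the factor \<open>monom 1 i\<close> does not affect simplicity. At
  the origin, the assumption says that \<open>h\<close> vanishes to order at most one, and the
  multiplier keeps the order of vanishing there.\<close>

lemma simple_rooted_laguerre: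
  assumes "real_rooted h" "coeff h 0 \<noteq> 0 \<or> coeff h 1 \<noteq> 0"
  shows "simple_rooted (laguerre i h)"
proof -
  define T where "T = laguerre i h"
  have "h \<noteq> 0" using assms(2) by auto
  then obtain A where A: "h = smult (lead_coeff h) (\<Prod>u\<in>#A. [:- u, 1:])"
    using real_rooted_splits assms(1) by blast
  have "laguerre i h = smult (lead_coeff h) (laguerre i (\<Prod>u\<in>#A. [:- u, 1:]))"
    using A laguerre_smult by metis
  then have E: "simple_nonzero_rooted (monom 1 i * T)"
    using simple_nonzero_rooted_laguerre_prod[of i 0 A] \<open>h \<noteq> 0\<close>
    by (simp add: T_def simple_nonzero_rooted_smult)
  have ev: "poly (monom 1 i * T) x = x ^ i * poly T x" for x
    by (simp add: poly_monom)
  have "T \<noteq> 0" using E by (auto simp: simple_nonzero_rooted_def)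
  moreover have "real_rooted T"
    using E by (auto simp: simple_nonzero_rooted_def real_rooted_def cpoly_mult)
  moreover have "poly (pderiv T) x \<noteq> 0" if x: "poly T x = 0" for x
  proof (cases "x = 0")
    case True
    then have "coeff h 0 = 0" using x by (simp add: T_def poly_0_coeff_0)
    then show ?thesis using assms(2) True by (simp add: poly_0_coeff_0 coeff_pderiv T_def)
  next
    case False
    then have "poly (pderiv (monom 1 i * T)) x \<noteq> 0"
      using E x by (simp add: simple_nonzero_rooted_def)
    then show ?thesis using x by (auto simp: pderiv_mult)
  qed
  ultimately show ?thesis by (simp add: simple_rooted_def T_def)
qed

subsection \<open>Pencils of real-rooted polynomials\<close>


text \<open>A repeated linear factor would give a common zero of \<open>f\<close> and its
  derivative, so the multiset of zeros is a set.\<close>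

lemma simple_rooted_splits:
  assumes "simple_rooted f"
  obtains U where "finite U" "f = smult (lead_coeff f) (\<Prod>u\<in>U. [:- u, 1:])"
proof -
  obtain A where A: "f = smult (lead_coeff f) (\<Prod>u\<in>#A. [:- u, 1:])"
    using real_rooted_splits assms by (auto simp: simple_rooted_def)
  have "count A u \<le> 1" for u
  proof (rule ccontr)
    assume "\<not> count A u \<le> 1"
    then have "{#u, u#} \<subseteq># A" by (auto simp: subseteq_mset_def)
    then obtain B where "A = {#u, u#} + B" by (metis subset_mset.add_diff_inverse)
    define P where "P = (\<Prod>u\<in>#B. [:- u, 1:])"
    have f: "f = smult (lead_coeff f) ([:- u, 1:] * ([:- u, 1:] * P))"
      using A unfolding \<open>A = _\<close> P_def by simp
    have "poly (pderiv (smult c ([:- u, 1:] * ([:- u, 1:] * P)))) u = 0"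
      "poly (smult c ([:- u, 1:] * ([:- u, 1:] * P))) u = 0" for c
      by (simp_all add: pderiv_smult pderiv_mult)
    then have "poly (pderiv f) u = 0" "poly f u = 0" using f by metis+
    then show False using assms by (simp add: simple_rooted_def)
  qed
  then have "A = mset_set (set_mset A)"
    by (intro multiset_eqI) (metis One_nat_def count_eq_zero_iff count_greater_zero_iff count_mset_set(1,3) finite_set_mset
        le_Suc_eq le_zero_eq)
  then have "(\<Prod>u\<in>#A. [:- u, 1:]) = (\<Prod>u\<in>set_mset A. [:- u, 1:])"
    by (metis prod_unfold_prod_mset)
  then show ?thesis using that[of "set_mset A"] A by simp
qed

lemma degree_prod_linear: "degree (\<Prod>u\<in>U. [:- u, 1:] :: real poly) = card U"
  by (cases "finite U") (simp_all add: degree_prod_sum_eq)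

lemma lead_coeff_prod_linear: "lead_coeff (\<Prod>u\<in>U. [:- u, 1:] :: real poly) = 1"
  by (simp add: lead_coeff_prod)

lemma poly_prod_linear: "poly (\<Prod>u\<in>U. [:- u, 1:]) x = (\<Prod>u\<in>U. x - u :: real)"
  by (simp add: poly_prod)

lemma proots_prod_linear: "finite U \<Longrightarrow> proots (\<Prod>u\<in>U. [:- u, 1:] :: real poly) = mset_set U"
  by (subst proots_prod) (auto simp: sum_unfold_sum_mset)

text \<open>The pencil condition of the Hermite-Kakeya-Obreschkoff theorem, in its strict form. It
  stands in for strict interlacing because a linear operator acts directly on linear combinations,
  but not on zeros.\<close>

definition simple_pencil :: "real poly \<Rightarrow> real poly \<Rightarrow> bool" where
  "simple_pencil f g \<longleftrightarrow>
     (\<forall>\<alpha> \<beta>. \<alpha> \<noteq> 0 \<or> \<beta> \<noteq> 0 \<longrightarrow> simple_rooted (smult \<alpha> f + smult \<beta> g))"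

lemma simple_pencilD:
  assumes "simple_pencil f g" "\<alpha> \<noteq> 0 \<or> \<beta> \<noteq> 0" "\<alpha> * poly f x + \<beta> * poly g x = 0"
  shows "\<alpha> * poly (pderiv f) x + \<beta> * poly (pderiv g) x \<noteq> 0"
  using assms(1)[unfolded simple_pencil_def simple_rooted_def, rule_format, OF assms(2)] assms(3)
  by (auto simp: pderiv_add pderiv_smult)

text \<open>If the Wronskian vanished at \<open>x\<close>, the member \<open>g(x) f - f(x) g\<close>
  of the pencil would have a multiple zero there. If \<open>f\<close> and \<open>g\<close> both
  vanish at \<open>x\<close>, the member \<open>g'(x) f - f'(x) g\<close> plays the same
  role.\<close>

lemma simple_pencil_wronskian:
  assumes "simple_pencil f g"
  shows "poly (pderiv f * g - f * pderiv g) x \<noteq> 0"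
proof (cases "poly f x = 0 \<and> poly g x = 0")
  case False
  then show ?thesis
    using simple_pencilD[OF assms, of "poly g x" "- poly f x" x] by (auto simp: algebra_simps)
next
  case True
  then have "poly (pderiv f) x \<noteq> 0"
    using simple_pencilD[OF assms, of 1 0 x] by simp
  then show ?thesis
    using True simple_pencilD[OF assms, of "poly (pderiv g) x" "- poly (pderiv f) x" x] by auto
qed

lemma poly_no_root_same_sign:
  fixes p :: "real poly"
  assumes "\<And>x. poly p x \<noteq> 0"
  shows "poly p x * poly p y > 0"
proof (rule ccontr)
  assume "\<not> ?thesis"
  then have neg: "poly p x * poly p y < 0" using assms by (simp add: less_le not_less)
  then have "x \<noteq> y" by auto
  then show False
    using poly_IVT[of x y p] poly_IVT[of y x p] neg assms
    by (cases "x < y") (auto simp: mult.commute)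
qed

text \<open>This is Lagrange interpolation of \<open>g\<close> at the zeros of \<open>f\<close>, or
  the partial fraction expansion of \<open>g/f\<close>. At a zero \<open>u\<close> the Wronskian is
  a positive multiple of \<open>w u\<close>; as it never changes sign, all weights have the same
  sign, and their sum decides which.\<close>

lemma simple_pencil_lagrange:
  assumes sp: "simple_pencil f g" and deg: "degree f = Suc (degree g)"
    and lead: "lead_coeff f > 0" "lead_coeff g > 0"
  obtains U w where "finite U" "card U = degree f"
    "f = smult (lead_coeff f) (\<Prod>u\<in>U. [:- u, 1:])"
    "g = (\<Sum>u\<in>U. smult (w u) (\<Prod>v\<in>U - {u}. [:- v, 1:]))"
    "\<forall>u\<in>U. w u > 0"
proof -
  have "simple_rooted f" using sp[unfolded simple_pencil_def, rule_format, of 1 0] by simp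
  then obtain U where U: "finite U" "f = smult (lead_coeff f) (\<Prod>u\<in>U. [:- u, 1:])"
    using simple_rooted_splits by blast
  define c where "c = lead_coeff f"
  define P where "P u = (\<Prod>v\<in>U - {u}. [:- v, 1:])" for u :: real
  \<comment> \<open>Up to the factor \<open>c\<close>, this is the residue of \<open>g/f\<close> at
    \<open>u\<close>.\<close>
  define w where "w u = poly g u / poly (P u) u" for u
  define W where "W = pderiv f * g - f * pderiv g"
  have c: "c > 0" using lead by (simp add: c_def)
  have fP: "f = smult c ([:- u, 1:] * P u)" if "u \<in> U" for u
    using U that by (simp add: c_def P_def prod.remove)
  have "degree f = degree (smult c (\<Prod>u\<in>U. [:- u, 1:]))" using U by (simp add: c_def)
  then have card: "card U = degree f" using c by (simp add: degree_prod_linear)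
  have Puv: "poly (P u) v = 0 \<longleftrightarrow> v \<noteq> u" if "v \<in> U" for u v
    using that U(1) by (auto simp: P_def poly_prod_linear)
  have degP: "degree (P u) = degree g" if "u \<in> U" for u
    using that U(1) card deg by (simp add: P_def degree_prod_linear)
  have g: "g = (\<Sum>u\<in>U. smult (w u) (P u))"
  proof (rule poly_eqI_degree[of U])
    fix v assume v: "v \<in> U"
    have "poly (\<Sum>u\<in>U. smult (w u) (P u)) v = (\<Sum>u\<in>U. w u * poly (P u) v)"
      by (simp add: poly_sum)
    also have "\<dots> = (\<Sum>u\<in>U. if u = v then w u * poly (P u) v else 0)"
      using Puv[OF v] by (intro sum.cong) auto
    also have "\<dots> = poly g v" using v U(1) Puv[OF v] by (simp add: w_def)
    finally show "poly g v = poly (\<Sum>u\<in>U. smult (w u) (P u)) v" ..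
  next
    show "degree g < card U" using card deg by simp
    have "degree (\<Sum>u\<in>U. smult (w u) (P u)) \<le> degree g"
      using degP by (intro degree_sum_le U) (auto intro: order.trans[OF degree_smult_le])
    then show "degree (\<Sum>u\<in>U. smult (w u) (P u)) < card U" using card deg by simp
  qed
  have W: "poly W u = c * w u * (poly (P u) u)\<^sup>2" if "u \<in> U" for u
  proof -
    have "poly (pderiv f) u = c * poly (P u) u" "poly f u = 0"
      unfolding fP[OF that] by (simp_all add: pderiv_smult pderiv_mult pderiv_pCons)
    then show ?thesis using Puv[OF that, of u] by (simp add: W_def w_def power2_eq_square)
  qed
  have W0: "poly W x \<noteq> 0" for x
    unfolding W_def by (rule simple_pencil_wronskian[OF sp])
  have same: "w u * w v > 0" if "u \<in> U" "v \<in> U" for u v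
  proof -
    have "poly W u * poly W v > 0" by (rule poly_no_root_same_sign[OF W0])
    moreover have "poly W u * poly W v = (c * poly (P u) u * poly (P v) v)\<^sup>2 * (w u * w v)"
      using that by (simp add: W power2_eq_square)
    ultimately show ?thesis by (metis zero_less_mult_pos zero_le_power2 zero_less_mult_iff order.strict_iff_order mult_zero_left)
  qed
  \<comment> \<open>Each \<open>P u\<close> is monic of degree \<open>degree g\<close>, so comparing
    leading coefficients shows that the weights sum to \<open>lead_coeff g\<close>.\<close>
  have "lead_coeff g = coeff (\<Sum>u\<in>U. smult (w u) (P u)) (degree g)" using g by simp
  also have "\<dots> = (\<Sum>u\<in>U. w u * coeff (P u) (degree g))" by (simp add: coeff_sum)
  also have "\<dots> = (\<Sum>u\<in>U. w u)"
  proof (intro sum.cong refl)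
    fix u assume "u \<in> U"
    have "coeff (P u) (degree g) = 1"
      using lead_coeff_prod_linear[of "U - {u}"] degP[OF \<open>u \<in> U\<close>] by (simp add: P_def)
    then show "w u * coeff (P u) (degree g) = w u" by simp
  qed
  finally have pos: "(\<Sum>u\<in>U. w u) > 0" using lead by simp
  have "w u > 0" if u: "u \<in> U" for u
  proof (rule ccontr)
    assume "\<not> w u > 0"
    then have "w v \<le> 0" if "v \<in> U" for v
      using same[OF u that] by (auto simp: zero_less_mult_iff)
    then have "(\<Sum>v\<in>U. w v) \<le> 0" by (rule sum_nonpos)
    with pos show False by simp
  qed
  then show ?thesis using that[of U w] U card g unfolding P_def by blast
qed

text \<open>The two products are the derivatives of the monic polynomial with zero set
  \<open>U\<close> at adjacent zeros. Every further zero lies on the same side of \<open>u\<close>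
  and \<open>v\<close> and contributes a positive factor; what remains is
  \<open>(u - v) * (v - u)\<close>.\<close>

lemma prod_linear_sign_change:
  fixes U :: "real set"
  assumes "finite U" "u \<in> U" "v \<in> U" "u < v" "\<And>t. t \<in> U \<Longrightarrow> t \<le> u \<or> v \<le> t"
  shows "(\<Prod>t\<in>U - {u}. u - t) * (\<Prod>t\<in>U - {v}. v - t) < 0"
proof -
  define R where "R = U - {u, v}"
  have "U - {u} = insert v R" "U - {v} = insert u R" "finite R" "u \<notin> R" "v \<notin> R"
    using assms by (auto simp: R_def)
  then have "(\<Prod>t\<in>U - {u}. u - t) * (\<Prod>t\<in>U - {v}. v - t) =
      ((u - v) * (v - u)) * (\<Prod>t\<in>R. (u - t) * (v - t))"
    by (simp add: prod.distrib)
  moreover have "(\<Prod>t\<in>R. (u - t) * (v - t)) > 0"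
  proof (intro prod_pos)
    fix t assume "t \<in> R"
    then have "t < u \<or> v < t" using assms(5)[of t] by (auto simp: R_def)
    then show "0 < (u - t) * (v - t)" using assms(4) by (auto simp: zero_less_mult_iff)
  qed
  moreover have "(u - v) * (v - u) < 0" using assms(4) by (simp add: mult_less_0_iff)
  ultimately show ?thesis by (simp add: mult_neg_pos)
qed

lemma zeros_desc_prod_linear:
  "c \<noteq> 0 \<Longrightarrow> finite U \<Longrightarrow>
    zeros_desc (smult c (\<Prod>u\<in>U. [:- u, 1:])) = rev (sorted_list_of_set U)"
  by (simp add: zeros_desc_def proots_prod_linear sorted_list_of_mset_set)

text \<open>With positive weights, \<open>g\<close> takes values of opposite sign at consecutive
  zeros of \<open>f\<close>. The intermediate value theorem puts a zero of \<open>g\<close> in each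
  of the \<open>d\<close> gaps, and by degree these are all its zeros.\<close>

lemma simple_pencil_imp_strictly_interlaces:
  assumes sp: "simple_pencil f g" and deg: "degree f = Suc (degree g)"
    and lead: "lead_coeff f > 0" "lead_coeff g > 0"
  shows "strictly_interlaces g f"
proof -
  define d where "d = degree g"
  obtain U w where U: "finite U" "card U = degree f"
    "f = smult (lead_coeff f) (\<Prod>u\<in>U. [:- u, 1:])"
    and g: "g = (\<Sum>u\<in>U. smult (w u) (\<Prod>v\<in>U - {u}. [:- v, 1:]))"
    and w: "\<forall>u\<in>U. w u > 0"
    using simple_pencil_lagrange[OF assms] .
  have cardU: "card U = Suc d" using U(2) deg by (simp add: d_def)
  define us where "us = sorted_list_of_set U"
  have us: "length us = Suc d" "set us = U" "sorted us" "distinct us"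
    using U(1) cardU by (simp_all add: us_def)
  have mono: "us ! i < us ! j" if "i < j" "j \<le> d" for i j
  proof (rule sorted_wrt_nth_less)
    show "sorted_wrt (<) us" by (simp add: us_def)
  qed (use that us(1) in auto)
  have gu: "poly g u = w u * (\<Prod>t\<in>U - {u}. u - t)" if "u \<in> U" for u
  proof -
    have "poly g u = (\<Sum>v\<in>U. w v * (\<Prod>t\<in>U - {v}. u - t))"
      unfolding g by (simp add: poly_sum poly_prod_linear)
    also have "\<dots> = (\<Sum>v\<in>U. if v = u then w v * (\<Prod>t\<in>U - {v}. u - t) else 0)"
      using that U(1) by (intro sum.cong) auto
    also have "\<dots> = w u * (\<Prod>t\<in>U - {u}. u - t)" using that U(1) by simp
    finally show ?thesis .
  qed
  have "\<exists>x. us ! i < x \<and> x < us ! Suc i \<and> poly g x = 0" if i: "i < d" for i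
  proof -
    let ?u = "us ! i" and ?v = "us ! Suc i"
    have "?u \<in> set us" "?v \<in> set us" using i us(1) by (auto intro!: nth_mem)
    then have uv: "?u \<in> U" "?v \<in> U" "?u < ?v" using i mono[of i "Suc i"] unfolding us(2) by simp_all
    have gap: "t \<le> ?u \<or> ?v \<le> t" if "t \<in> U" for t
    proof -
      have "t \<in> set us" using that unfolding us(2) .
      then obtain j where j: "j < length us" "t = us ! j"
        unfolding in_set_conv_nth by blast
      have "us ! j \<le> us ! i" if "j \<le> i"
        using sorted_nth_mono[OF us(3) that] i us(1) by simp
      moreover have "us ! Suc i \<le> us ! j" if "Suc i \<le> j"
        using sorted_nth_mono[OF us(3) that] j(1) by simp
      ultimately show ?thesis unfolding j(2) by linarith
    qed
    have "poly g ?u * poly g ?v =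
      (w ?u * w ?v) * ((\<Prod>t\<in>U - {?u}. ?u - t) * (\<Prod>t\<in>U - {?v}. ?v - t))"
      using gu uv by simp
    moreover have "w ?u * w ?v > 0" using w uv by simp
    ultimately have "poly g ?u * poly g ?v < 0"
      using prod_linear_sign_change[OF U(1) uv gap] by (simp only: mult_pos_neg)
    then show ?thesis using poly_IVT[OF uv(3)] by blast
  qed
  then obtain r where r: "\<And>i. i < d \<Longrightarrow> us ! i < r i \<and> r i < us ! Suc i \<and> poly g (r i) = 0"
    by metis
  define vs where "vs = map r [0..<d]"
  have rmono: "r i < r j" if "i < j" "j < d" for i j
  proof -
    have "us ! Suc i \<le> us ! j" using us that by (intro sorted_nth_mono) auto
    then show ?thesis using r[of i] r[of j] that by auto
  qed
  have vs: "sorted_wrt (<) vs" "length vs = d"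
    using rmono by (auto simp: vs_def sorted_wrt_iff_nth_less)
  have sg: "simple_rooted g" and sf: "simple_rooted f"
    using sp[unfolded simple_pencil_def, rule_format, of 0 1]
      sp[unfolded simple_pencil_def, rule_format, of 1 0] by simp_all
  then obtain V where V: "finite V" "g = smult (lead_coeff g) (\<Prod>u\<in>V. [:- u, 1:])"
    using simple_rooted_splits by blast
  have "degree g = degree (smult (lead_coeff g) (\<Prod>u\<in>V. [:- u, 1:]))"
    using arg_cong[OF V(2), of degree] .
  then have "card V = d" using lead by (simp add: degree_prod_linear d_def del: leading_coeff_0_iff)
  have roots: "poly (smult (lead_coeff g) (\<Prod>u\<in>V. [:- u, 1:])) x = 0 \<Longrightarrow> x \<in> V" for x
    using lead V(1) by (auto simp: poly_prod_linear)
  have "set vs \<subseteq> V"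
    using r roots unfolding V(2)[symmetric] by (auto simp: vs_def)
  moreover have "card (set vs) = d"
    using vs by (metis distinct_card strict_sorted_iff)
  ultimately have "set vs = V" using \<open>card V = d\<close> V(1) by (metis card_subset_eq)
  then have "sorted_list_of_set V = vs"
    using vs V(1) by (metis sorted_list_of_set.idem_if_sorted_distinct strict_sorted_iff)
  then have zg: "zeros_desc g = rev vs"
    using zeros_desc_prod_linear[of "lead_coeff g" V] V(1) lead
    unfolding V(2)[symmetric] \<open>sorted_list_of_set V = vs\<close> by force
  have zf: "zeros_desc f = rev us"
    using zeros_desc_prod_linear[of "lead_coeff f" U] U(1) lead
    unfolding U(3)[symmetric] us_def by force
  have "zeros_desc f ! (i + 1) < zeros_desc g ! i \<and> zeros_desc g ! i < zeros_desc f ! i"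
    if i: "i < degree g" for i
  proof -
    have "i < d" using i by (simp add: d_def)
    \<comment> \<open>\<open>us\<close> has one entry more than \<open>vs\<close>: position
      \<open>i\<close> of the reversed lists is entry \<open>d - i\<close> of \<open>us\<close> but
      entry \<open>d - Suc i\<close> of \<open>vs\<close>.\<close>
    then have "rev us ! (i + 1) = us ! (d - Suc i)" "rev us ! i = us ! Suc (d - Suc i)"
      "rev vs ! i = r (d - Suc i)"
      using us(1) vs(2) by (simp_all add: rev_nth Suc_diff_Suc vs_def)
    then show ?thesis using r[of "d - Suc i"] \<open>i < d\<close> unfolding zf zg by simp
  qed
  then show ?thesis
    using sf sg deg by (simp add: interlaces_wrt_def simple_rooted_def)
qed

text \<open>Dividing by \<open>f\<close> leaves \<open>\<alpha>\<close> plus \<open>\<beta>\<close>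
  times a positive combination of the terms \<open>z/(z - u)\<close>. For \<open>u < 0\<close> the
  imaginary part of each term has the sign of \<open>Im z\<close>, so for
  \<open>\<beta> \<noteq> 0\<close> nothing can cancel at a nonreal \<open>z\<close>.\<close>

lemma simple_pencil_real_rooted_shift:
  assumes sp: "simple_pencil f g" and deg: "degree f = Suc (degree g)"
    and lead: "lead_coeff f > 0" "lead_coeff g > 0"
    and neg: "\<And>x. poly f x = 0 \<Longrightarrow> x < 0"
  shows "real_rooted (smult \<alpha> f + smult \<beta> (pCons 0 g))"
proof (cases "\<beta> = 0")
  case True
  have "real_rooted f"
    using sp[unfolded simple_pencil_def simple_rooted_def, rule_format, of 1 0] by simp
  then show ?thesis using True by (auto simp: real_rooted_def cpoly_smult)
next
  case False
  obtain U w where U: "finite U" "card U = degree f"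
    "f = smult (lead_coeff f) (\<Prod>u\<in>U. [:- u, 1:])"
    and g: "g = (\<Sum>u\<in>U. smult (w u) (\<Prod>v\<in>U - {u}. [:- v, 1:]))"
    and w: "\<forall>u\<in>U. w u > 0"
    using simple_pencil_lagrange[OF assms(1-4)] .
  define c where "c = lead_coeff f"
  have fc: "f = smult c (\<Prod>u\<in>U. [:- u, 1:])" unfolding c_def by (rule U(3))
  have negU: "u < 0" if "u \<in> U" for u
  proof -
    have "poly f u = 0" unfolding fc using that U(1) by (auto simp: poly_prod_linear)
    then show ?thesis by (rule neg)
  qed
  have "U \<noteq> {}" using U(2) deg by auto
  have "z \<in> \<real>" if z: "cpoly (smult \<alpha> f + smult \<beta> (pCons 0 g)) z = 0" for z
  proof (rule ccontr)
    assume "z \<notin> \<real>"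
    then have Im: "Im z \<noteq> 0" by (simp add: complex_is_Real_iff)
    define F where "F = (\<Prod>u\<in>U. z - complex_of_real u)"
    have nz: "z - complex_of_real u \<noteq> 0" for u using Im by auto
    then have F: "F \<noteq> 0" by (simp add: F_def U(1))
    have lin: "cpoly [:- u, 1:] z = z - complex_of_real u" for u
      by (simp add: cpoly_simps)
    have "cpoly f z = c * F" unfolding fc by (simp add: cpoly_smult cpoly_prod lin F_def)
    moreover have "cpoly g z = (\<Sum>u\<in>U. w u * (F / (z - u)))"
    proof -
      have "cpoly g z = (\<Sum>u\<in>U. w u * (\<Prod>v\<in>U - {u}. z - complex_of_real v))"
        unfolding g by (simp add: cpoly_sum cpoly_smult cpoly_prod lin)
      also have "\<dots> = (\<Sum>u\<in>U. w u * (F / (z - u)))"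
        using nz U(1) by (intro sum.cong refl) (simp add: F_def prod.remove)
      finally show ?thesis .
    qed
    ultimately have "0 = \<alpha> * (c * F) + \<beta> * (z * (\<Sum>u\<in>U. w u * (F / (z - u))))"
      using z by (simp add: cpoly_add cpoly_smult cpoly_pCons mult.left_commute[of z])
    also have "\<dots> = F * (complex_of_real (\<alpha> * c) + complex_of_real \<beta> * (\<Sum>u\<in>U. w u * (z / (z - u))))"
      by (simp add: algebra_simps sum_distrib_left)
    finally have "Im (complex_of_real (\<alpha> * c) + complex_of_real \<beta> * (\<Sum>u\<in>U. w u * (z / (z - u)))) = 0"
      using F by simp
    then have "\<beta> * (\<Sum>u\<in>U. w u * Im (z / (z - u))) = 0"
      by (simp del: times_divide_eq_right)
    moreover have "Im (z / (z - complex_of_real u)) = - u * Im z / (cmod (z - u))\<^sup>2" for u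
      by (simp add: Im_divide cmod_power2 algebra_simps)
    ultimately have "(\<Sum>u\<in>U. w u * (- u * Im z / (cmod (z - u))\<^sup>2)) = 0"
      using False by simp
    then have "Im z * (\<Sum>u\<in>U. w u * (- u) / (cmod (z - u))\<^sup>2) = 0"
      by (simp add: sum_distrib_left mult_ac)
    moreover have "(\<Sum>u\<in>U. w u * (- u) / (cmod (z - u))\<^sup>2) > 0"
      using U(1) \<open>U \<noteq> {}\<close> negU w nz by (intro sum_pos divide_pos_pos mult_pos_pos) auto
    ultimately show False using Im by simp
  qed
  then show ?thesis by (simp add: real_rooted_def)
qed

subsection \<open>Convolution polynomials\<close>


lemma cpoly_altdef:
  assumes "degree f \<le> n"
  shows "cpoly f z = (\<Sum>k\<le>n. complex_of_real (coeff f k) * z ^ k)"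
proof -
  have "cpoly f z = (\<Sum>k\<le>degree f. complex_of_real (coeff f k) * z ^ k)"
    by (simp add: poly_altdef degree_map_poly coeff_map_poly)
  also have "\<dots> = (\<Sum>k\<le>n. complex_of_real (coeff f k) * z ^ k)"
    using assms by (intro sum.mono_neutral_left) (auto simp: coeff_eq_0)
  finally show ?thesis .
qed

text \<open>For \<open>z \<noteq> 0\<close> the value \<open>q(z)\<close> equals
  \<open>z^n p(1/z)\<close>, and inversion preserves the reals. The length \<open>n\<close> may
  exceed the degrees, which covers combinations whose leading coefficients cancel.\<close>

lemma real_rooted_reversal:
  assumes "real_rooted p" "degree p \<le> n" "degree q \<le> n"
    and rev: "\<And>k. k \<le> n \<Longrightarrow> coeff q k = coeff p (n - k)"
  shows "real_rooted q"
proof (cases "p = 0")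
  case True
  then have "coeff q k = 0" for k
    using rev[of k] assms(3) by (cases "k \<le> n") (auto simp: coeff_eq_0)
  then show ?thesis by (simp add: real_rooted_def poly_eq_iff)
next
  case False
  have "z \<in> \<real>" if z: "cpoly q z = 0" for z
  proof (cases "z = 0")
    case nz: False
    have "cpoly q z = (\<Sum>k\<le>n. complex_of_real (coeff p (n - k)) * z ^ k)"
      unfolding cpoly_altdef[OF assms(3)] using rev by (intro sum.cong) auto
    also have "\<dots> = (\<Sum>k\<le>n. complex_of_real (coeff p k) * z ^ (n - k))"
      by (rule sum.reindex_bij_witness[of _ "\<lambda>k. n - k" "\<lambda>k. n - k"]) auto
    also have "\<dots> = (\<Sum>k\<le>n. z ^ n * (complex_of_real (coeff p k) * inverse z ^ k))"
      using nz by (intro sum.cong refl) (simp add: power_diff field_simps)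
    also have "\<dots> = z ^ n * cpoly p (inverse z)"
      unfolding cpoly_altdef[OF assms(2)] by (simp add: sum_distrib_left)
    finally have "cpoly p (inverse z) = 0" using z nz by simp
    then have "inverse z \<in> \<real>" using assms(1) False unfolding real_rooted_def by blast
    then show ?thesis by simp
  qed simp
  then show ?thesis by (simp add: real_rooted_def)
qed

text \<open>Two separate sequences allow the multiplier to act on one side at a time; reversing the
  coefficients exchanges \<open>a\<close> and \<open>b\<close>.\<close>

definition conv_poly :: "(nat \<Rightarrow> real) \<Rightarrow> (nat \<Rightarrow> real) \<Rightarrow> nat \<Rightarrow> real poly" where
  "conv_poly a b d = (\<Sum>k\<le>d. monom (a k * b (d - k)) k)"

lemma coeff_conv_poly: "coeff (conv_poly a b d) k = (if k \<le> d then a k * b (d - k) else 0)"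
  by (simp add: conv_poly_def coeff_sum if_distrib cong: if_cong)

lemma degree_conv_poly:
  assumes "a d \<noteq> 0" "b 0 \<noteq> 0"
  shows "degree (conv_poly a b d) = d"
proof (rule antisym)
  show "degree (conv_poly a b d) \<le> d" by (rule degree_le) (simp add: coeff_conv_poly)
  show "d \<le> degree (conv_poly a b d)" using assms by (intro le_degree) (simp add: coeff_conv_poly)
qed

lemma laguerre_conv_poly:
  "laguerre i (conv_poly a b d) = conv_poly (\<lambda>k. a k / fact (k + i)) b d"
  by (rule poly_eqI) (simp add: coeff_conv_poly)

definition pos_logconcave :: "(nat \<Rightarrow> real) \<Rightarrow> bool" where
  "pos_logconcave a \<longleftrightarrow> (\<forall>k. a k > 0) \<and> (\<forall>k. a k * a (Suc (Suc k)) < (a (Suc k))\<^sup>2)"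

text \<open>Multiple zeros are allowed here, since the pencil at \<open>m = 1\<close> contains
  powers of \<open>1 + t\<close>.\<close>

definition real_pencil :: "real poly \<Rightarrow> real poly \<Rightarrow> bool" where
  "real_pencil f g \<longleftrightarrow> (\<forall>\<alpha> \<beta>. real_rooted (smult \<alpha> f + smult \<beta> g))"

text \<open>For \<open>d > 0\<close>, vanishing of both coefficients is a homogeneous linear system
  for \<open>\<alpha>\<close> and \<open>\<beta>\<close>. Up to nonzero factors its determinant is
  \<open>a(d)^2 - a(d-1) a(d+1)\<close>, which strict log-concavity makes positive.\<close>

lemma conv_poly_pencil_low_coeffs:
  fixes d :: nat
  assumes "pos_logconcave a" "pos_logconcave b" "\<alpha> \<noteq> 0 \<or> \<beta> \<noteq> 0"
  defines "h \<equiv> smult \<alpha> (conv_poly b a (Suc d)) + smult \<beta> (conv_poly b a d)"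
  shows "coeff h 0 \<noteq> 0 \<or> coeff h 1 \<noteq> 0"
proof (rule ccontr)
  have pos: "a k > 0" "b k > 0" for k using assms by (auto simp: pos_logconcave_def)
  have nz: "a k \<noteq> 0" "b k \<noteq> 0" for k using pos[of k] by auto
  assume "\<not> ?thesis"
  then have h: "coeff h 0 = 0" "coeff h 1 = 0" by auto
  have "b 0 * (\<alpha> * a (Suc d) + \<beta> * a d) = 0"
    using h(1) by (simp add: h_def coeff_conv_poly algebra_simps)
  then have 1: "\<alpha> * a (Suc d) + \<beta> * a d = 0" using nz by simp
  have "\<alpha> = 0"
  proof (cases d)
    case 0
    \<comment> \<open>For \<open>d = 0\<close> only the first polynomial has a coefficient at index
      1.\<close>
    then show ?thesis using h(2) nz by (simp add: h_def coeff_conv_poly)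
  next
    case (Suc e)
    have "b 1 * (\<alpha> * a (Suc e) + \<beta> * a e) = 0"
      using h(2) by (simp add: h_def coeff_conv_poly Suc algebra_simps)
    then have 2: "\<alpha> * a (Suc e) + \<beta> * a e = 0" using nz by simp
    have "\<alpha> * ((a (Suc e))\<^sup>2 - a e * a (Suc (Suc e))) =
        a (Suc e) * (\<alpha> * a (Suc e) + \<beta> * a e) - a e * (\<alpha> * a (Suc d) + \<beta> * a d)"
      by (simp add: Suc power2_eq_square algebra_simps)
    then have "\<alpha> * ((a (Suc e))\<^sup>2 - a e * a (Suc (Suc e))) = 0" using 1 2 by simp
    moreover have "a e * a (Suc (Suc e)) < (a (Suc e))\<^sup>2"
      using assms(1) by (simp add: pos_logconcave_def)
    ultimately show ?thesis by simp
  qed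
  then show False using 1 nz assms(3) by simp
qed

text \<open>By linearity the multiplier acts on the whole pencil at once; the bound on the order of
  vanishing at the origin comes from \<open>conv_poly_pencil_low_coeffs\<close>.\<close>

lemma simple_pencil_laguerre:
  assumes "real_pencil (conv_poly b a (Suc d)) (conv_poly b a d)"
    "pos_logconcave a" "pos_logconcave b"
  shows "simple_pencil (laguerre i (conv_poly b a (Suc d))) (laguerre i (conv_poly b a d))"
  unfolding simple_pencil_def laguerre_smult[symmetric] laguerre_add[symmetric]
  using assms(1) conv_poly_pencil_low_coeffs[OF assms(2,3)]
  by (intro allI impI simple_rooted_laguerre) (auto simp only: real_pencil_def)

text \<open>Reversal with respect to the common length \<open>Suc d\<close> exchanges the two
  sequences and puts an extra factor \<open>t\<close> on the polynomial of degree \<open>d\<close>.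
  The combinations \<open>\<alpha> f + \<beta> t g\<close> that arise are those of
  \<open>simple_pencil_real_rooted_shift\<close>.\<close>

lemma real_pencil_conv_poly_swap:
  assumes sp: "simple_pencil (conv_poly a b (Suc d)) (conv_poly a b d)"
    and pos: "\<And>k. a k > 0" "\<And>k. b k > 0"
  shows "real_pencil (conv_poly b a (Suc d)) (conv_poly b a d)"
  unfolding real_pencil_def
proof (intro allI)
  fix \<alpha> \<beta>
  have nz: "a k \<noteq> 0" "b k \<noteq> 0" for k using pos[of k] by auto
  have deg: "degree (conv_poly a b e) = e" "degree (conv_poly b a e) = e" for e
    using nz by (simp_all add: degree_conv_poly)
  have lead: "lead_coeff (conv_poly a b e) > 0" for e
    using pos by (simp add: deg coeff_conv_poly)
  \<comment> \<open>All coefficients are positive, so at \<open>x \<ge> 0\<close> the value is at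
    least the constant term.\<close>
  have neg: "x < 0" if "poly (conv_poly a b (Suc d)) x = 0" for x
  proof (rule ccontr)
    assume "\<not> x < 0"
    then have "(\<Sum>k\<le>Suc d. a k * b (Suc d - k) * x ^ k) \<ge> a 0 * b (Suc d - 0) * x ^ 0"
      using pos by (intro member_le_sum) (auto intro!: mult_nonneg_nonneg less_imp_le[OF pos(1)] less_imp_le[OF pos(2)])
    moreover have "poly (conv_poly a b (Suc d)) x = (\<Sum>k\<le>Suc d. a k * b (Suc d - k) * x ^ k)"
      by (simp only: conv_poly_def poly_sum poly_monom)
    ultimately have "a 0 * b (Suc d) \<le> 0" using that by simp
    then show False using mult_pos_pos[OF pos(1)[of 0] pos(2)[of "Suc d"]] by linarith
  qed
  let ?p = "smult \<alpha> (conv_poly a b (Suc d)) + smult \<beta> (pCons 0 (conv_poly a b d))"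
  let ?q = "smult \<alpha> (conv_poly b a (Suc d)) + smult \<beta> (conv_poly b a d)"
  show "real_rooted ?q"
  proof (rule real_rooted_reversal[of ?p "Suc d"])
    show "real_rooted ?p"
      using simple_pencil_real_rooted_shift[OF sp _ lead lead neg] deg by simp
    show "degree ?p \<le> Suc d"
      by (intro degree_add_le order.trans[OF degree_smult_le] order.trans[OF degree_pCons_le])
        (simp_all add: deg)
    show "degree ?q \<le> Suc d"
      by (intro degree_add_le order.trans[OF degree_smult_le]) (simp_all add: deg)
    fix k assume k: "k \<le> Suc d"
    show "coeff ?q k = coeff ?p (Suc d - k)"
    proof (cases "k \<le> d")
      case True
      then show ?thesis by (simp add: coeff_conv_poly Suc_diff_le mult.commute)
    next
      case False
      then have "k = Suc d" using k by simp
      then show ?thesis by (simp add: coeff_conv_poly)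
    qed
  qed
qed

section \<open>Products of inverse factorials and the recursion in m\<close>

definition inv_fact_prod :: "nat \<Rightarrow> nat \<Rightarrow> real" where
  "inv_fact_prod m k = (\<Prod>i<m. 1 / fact (k + i))"

lemma inv_fact_prod_Suc: "inv_fact_prod (Suc m) k = inv_fact_prod m k / fact (k + m)"
  by (simp add: inv_fact_prod_def)

text \<open>Each factor is strictly log-concave, because
  \<open>(k+i+1)!^2 < (k+i)! (k+i+2)!\<close>, and the inequalities multiply;
  \<open>m \<ge> 1\<close> provides at least one strict factor.\<close>

lemma pos_logconcave_inv_fact_prod:
  assumes "m \<ge> 1"
  shows "pos_logconcave (inv_fact_prod m)"
  unfolding pos_logconcave_def
proof (intro conjI allI)
  fix k
  show "inv_fact_prod m k > 0" by (simp add: inv_fact_prod_def prod_pos)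
  have less: "1 / fact (k + i) * (1 / fact (Suc (Suc k) + i)) < (1 / fact (Suc k + i) :: real)\<^sup>2" for i
  proof -
    have "(fact (Suc k + i) :: real)\<^sup>2 < fact (k + i) * fact (Suc (Suc k) + i)"
    proof -
      have "real (Suc (k + i)) * (fact (k + i) * fact (Suc k + i)) <
          real (Suc (Suc (k + i))) * (fact (k + i) * fact (Suc k + i))"
        by (intro mult_strict_right_mono) auto
      then show ?thesis by (simp add: power2_eq_square mult_ac)
    qed
    then show ?thesis by (simp add: power_divide frac_less2)
  qed
  have "(\<Prod>i<m. 1 / fact (k + i) * (1 / fact (Suc (Suc k) + i))) < (\<Prod>i<m. (1 / fact (Suc k + i) :: real)\<^sup>2)"
  proof (rule prod_mono_strict[of 0])
    show "1 / fact (k + 0) * (1 / fact (Suc (Suc k) + 0)) < (1 / fact (Suc k + 0) :: real)\<^sup>2"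
      by (rule less)
    show "0 \<le> (1 / fact (k + i) :: real) * (1 / fact (Suc (Suc k) + i)) \<and>
        1 / fact (k + i) * (1 / fact (Suc (Suc k) + i)) \<le> (1 / fact (Suc k + i) :: real)\<^sup>2" for i
      by (intro conjI mult_nonneg_nonneg less_imp_le[OF less]) auto
  qed (use assms in \<open>auto simp del: fact_Suc\<close>)
  then show "inv_fact_prod m k * inv_fact_prod m (Suc (Suc k)) < (inv_fact_prod m (Suc k))\<^sup>2"
    unfolding inv_fact_prod_def by (simp only: prod.distrib prod_power_distrib)
qed

text \<open>\<open>1/(k! (d-k)!)\<close> is a binomial coefficient divided by
  \<open>d!\<close>.\<close>

lemma conv_poly_inv_fact:
  "conv_poly (inv_fact_prod 1) (inv_fact_prod 1) d = smult (1 / fact d) ([:1, 1:] ^ d)"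
proof (rule poly_eqI)
  fix k
  show "coeff (conv_poly (inv_fact_prod 1) (inv_fact_prod 1) d) k = coeff (smult (1 / fact d) ([:1, 1:] ^ d)) k"
  proof (cases "k \<le> d")
    case True
    then show ?thesis
      by (simp add: coeff_conv_poly inv_fact_prod_def coeff_linear_poly_power binomial_fact)
  next
    case False
    then have "coeff ([:1, 1:] ^ d :: real poly) k = 0"
      by (intro coeff_eq_0) (simp add: degree_power_eq)
    then show ?thesis using False by (simp add: coeff_conv_poly)
  qed
qed

text \<open>Every combination is \<open>(1 + t)^d\<close> times a polynomial of degree at most
  one.\<close>

lemma real_pencil_inv_fact:
  "real_pencil (conv_poly (inv_fact_prod 1) (inv_fact_prod 1) (Suc d))
     (conv_poly (inv_fact_prod 1) (inv_fact_prod 1) d)"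
  unfolding real_pencil_def
proof (intro allI)
  fix \<alpha> \<beta> :: real
  define s t where "s = \<alpha> / fact (Suc d)" and "t = \<beta> / fact d"
  have "smult \<alpha> (conv_poly (inv_fact_prod 1) (inv_fact_prod 1) (Suc d)) +
      smult \<beta> (conv_poly (inv_fact_prod 1) (inv_fact_prod 1) d) = [:1, 1:] ^ d * [:s + t, s:]"
  proof -
    define P :: "real poly" where "P = [:1, 1:]"
    have st: "[:s + t, s:] = smult s P + [:t:]" by (simp add: P_def)
    have "P ^ d * [:t:] = smult t (P ^ d)" by (simp add: mult_pCons_right)
    then show ?thesis
      unfolding conv_poly_inv_fact st P_def[symmetric]
      by (simp add: s_def t_def distrib_left mult.commute del: fact_Suc)
  qed
  moreover have "real_rooted ([:1, 1:] ^ d * [:s + t, s:])"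
  proof (cases "s = 0 \<and> t = 0")
    case True
    then show ?thesis by (simp add: real_rooted_def)
  next
    case False
    have pw: "cpoly ([:1, 1:] ^ d) z = (1 + z) ^ d" for z
      by (induction d) (simp_all add: cpoly_simps)
    have "z \<in> \<real>" if "cpoly ([:1, 1:] ^ d * [:s + t, s:]) z = 0" for z
    proof -
      have "1 + z = 0 \<or> complex_of_real (s + t) + z * complex_of_real s = 0"
        using that by (auto simp: cpoly_mult pw cpoly_pCons)
      moreover from this have "Im (1 + z) = 0 \<or> Im (complex_of_real (s + t) + z * complex_of_real s) = 0"
        by (metis zero_complex.sel(2))
      \<comment> \<open>For \<open>s = 0\<close> the second factor is the nonzero constant
        \<open>t\<close>, which leaves only the zero at -1.\<close>
      ultimately have "Im z = 0" using False by (cases "s = 0") (auto simp: complex_eq_iff)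
      then show ?thesis by (simp add: complex_is_Real_iff)
    qed
    then show ?thesis by (simp add: real_rooted_def)
  qed
  ultimately show "real_rooted (smult \<alpha> (conv_poly (inv_fact_prod 1) (inv_fact_prod 1) (Suc d)) +
      smult \<beta> (conv_poly (inv_fact_prod 1) (inv_fact_prod 1) d))" by simp
qed

lemma simple_pencil_imp_real_pencil:
  assumes "simple_pencil f g"
  shows "real_pencil f g"
  unfolding real_pencil_def
proof (intro allI)
  fix \<alpha> \<beta>
  show "real_rooted (smult \<alpha> f + smult \<beta> g)"
    using assms by (cases "\<alpha> = 0 \<and> \<beta> = 0")
      (auto simp: simple_pencil_def simple_rooted_def real_rooted_def)
qed

text \<open>One step in \<open>m\<close> changes both sequences: the multiplier raises the first,
  reversal exchanges the two, and the multiplier raises the other.\<close>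

lemma simple_pencil_inv_fact_prod:
  assumes "m \<ge> 2"
  shows "simple_pencil (conv_poly (inv_fact_prod m) (inv_fact_prod m) (Suc d))
     (conv_poly (inv_fact_prod m) (inv_fact_prod m) d)"
proof -
  \<comment> \<open>The step starts from a real pencil, so it also leads from \<open>m = 1\<close>,
    where zeros are multiple, to \<open>m = 2\<close>.\<close>
  have raise: "simple_pencil (conv_poly (inv_fact_prod (Suc m)) (inv_fact_prod (Suc m)) (Suc d))
     (conv_poly (inv_fact_prod (Suc m)) (inv_fact_prod (Suc m)) d)"
    if "m \<ge> 1" and rp: "real_pencil (conv_poly (inv_fact_prod m) (inv_fact_prod m) (Suc d))
     (conv_poly (inv_fact_prod m) (inv_fact_prod m) d)" for m
  proof -
    define a a' where "a = inv_fact_prod m" and "a' = inv_fact_prod (Suc m)"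
    have lc: "pos_logconcave a" "pos_logconcave a'"
      using \<open>m \<ge> 1\<close> by (simp_all add: a_def a'_def pos_logconcave_inv_fact_prod)
    then have pos: "a k > 0" "a' k > 0" for k by (auto simp: pos_logconcave_def)
    have lag: "laguerre m (conv_poly a b e) = conv_poly a' b e" for b e
      unfolding laguerre_conv_poly a_def a'_def inv_fact_prod_Suc ..
    have "simple_pencil (conv_poly a' a (Suc d)) (conv_poly a' a d)"
      using simple_pencil_laguerre[OF rp, of m] lc unfolding a_def[symmetric] lag by blast
    then have "real_pencil (conv_poly a a' (Suc d)) (conv_poly a a' d)"
      using real_pencil_conv_poly_swap pos by blast
    then show ?thesis
      using simple_pencil_laguerre[of a a' d m] lc unfolding lag a'_def[symmetric] by blast
  qed
  show ?thesis
    using assms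
  proof (induction m rule: dec_induct)
    case base
    show ?case using raise[of 1] real_pencil_inv_fact by (simp add: numeral_2_eq_2)
  next
    case (step n)
    then show ?case using raise[of n] simple_pencil_imp_real_pencil by simp
  qed
qed

section \<open>Hoggatt polynomials as convolution polynomials\<close>

lemma hoggatt_conv_poly:
  assumes "m \<ge> 1"
  obtains c where "c > 0" "hoggatt m (Suc d) = smult c (conv_poly (inv_fact_prod m) (inv_fact_prod m) d)"
proof -
  obtain m' where m: "m = Suc m'" using assms by (cases m) auto
  define N where "N = Suc d + m - 2"
  have N: "N = d + m'" by (simp add: N_def m)
  define D where "D = (\<Prod>j=1..m-1. real (N choose j))"
  have "D > 0" unfolding D_def by (intro prod_pos) (auto simp: N m)
  have "(\<Prod>i=0..m-1. real (N choose (k + i))) = fact N ^ m * (inv_fact_prod m k * inv_fact_prod m (d - k))"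
    if k: "k \<le> d" for k
  proof -
    \<comment> \<open>Each binomial coefficient is \<open>N!\<close> over \<open>(k+i)!\<close> and
      \<open>(d-k+m'-i)!\<close>. Replacing \<open>i\<close> by \<open>m' - i\<close> turns the
      product over the second factorials into the one defining
      \<open>inv_fact_prod m (d - k)\<close>.\<close>
    have "(\<Prod>i=0..m-1. real (N choose (k + i))) =
        (\<Prod>i<m. fact N * (1 / fact (k + i) * (1 / fact (d - k + (m' - i)))))"
    proof (intro prod.cong)
      fix i assume "i \<in> {..<m}"
      then have "k + i \<le> N" "N - (k + i) = d - k + (m' - i)" using k by (auto simp: N m)
      then show "real (N choose (k + i)) = fact N * (1 / fact (k + i) * (1 / fact (d - k + (m' - i))))"
        by (simp add: binomial_fact)
    qed (auto simp: m)
    also have "\<dots> = fact N ^ m * (inv_fact_prod m k * (\<Prod>i<m. 1 / fact (d - k + (m' - i))))"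
      unfolding inv_fact_prod_def by (simp only: prod.distrib prod_constant card_lessThan)
    also have "(\<Prod>i<m. 1 / fact (d - k + (m' - i))) = inv_fact_prod m (d - k)"
      unfolding inv_fact_prod_def m
      by (rule prod.reindex_bij_witness[of _ "\<lambda>i. m' - i" "\<lambda>i. m' - i"]) auto
    finally show ?thesis .
  qed
  then have "hoggatt m (Suc d) = smult (fact N ^ m / D) (conv_poly (inv_fact_prod m) (inv_fact_prod m) d)"
    unfolding hoggatt_def N_def[symmetric] D_def[symmetric]
    by (intro poly_eqI) (simp add: coeff_conv_poly coeff_sum if_distrib atLeast0AtMost cong: if_cong)
  moreover have "fact N ^ m / D > 0" using \<open>D > 0\<close> by simp
  ultimately show ?thesis using that by blast
qed

lemma simple_pencil_smult:
  assumes "simple_pencil f g" "a \<noteq> 0" "b \<noteq> 0"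
  shows "simple_pencil (smult a f) (smult b g)"
  using assms by (simp add: simple_pencil_def)

lemma strictly_interlaces_hoggatt:
  assumes "m \<ge> 2"
  shows "strictly_interlaces (hoggatt m (Suc d)) (hoggatt m (Suc (Suc d)))"
proof -
  define Q where "Q = conv_poly (inv_fact_prod m) (inv_fact_prod m)"
  have pos: "inv_fact_prod m k > 0" for k by (simp add: inv_fact_prod_def prod_pos)
  have deg: "degree (Q e) = e" for e
    unfolding Q_def using pos[of e] pos[of 0] by (intro degree_conv_poly) auto
  have lead: "lead_coeff (Q e) > 0" for e
    unfolding deg by (simp add: Q_def coeff_conv_poly pos)
  obtain c1 c2 where c: "c1 > 0" "hoggatt m (Suc (Suc d)) = smult c1 (Q (Suc d))"
      "c2 > 0" "hoggatt m (Suc d) = smult c2 (Q d)"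
    using hoggatt_conv_poly[of m d] hoggatt_conv_poly[of m "Suc d"] assms unfolding Q_def
    by (metis one_le_numeral order.trans)
  have "simple_pencil (smult c1 (Q (Suc d))) (smult c2 (Q d))"
    using simple_pencil_smult[OF simple_pencil_inv_fact_prod[OF assms]] c(1,3) unfolding Q_def by simp
  then show ?thesis
    unfolding c(2,4) using c(1,3) lead
    by (intro simple_pencil_imp_strictly_interlaces) (simp_all add: deg)
qed

text \<open>All zeros equal -1, so every interlacing inequality is an equality; this is why
  \<open>m = 1\<close> yields only the weak notion.\<close>

lemma interlaces_hoggatt_1:
  "interlaces (hoggatt 1 (Suc d)) (hoggatt 1 (Suc (Suc d)))"
proof -
  have hog: "\<exists>c. c > 0 \<and> hoggatt 1 (Suc e) = smult c ([:1, 1:] ^ e)" for e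
  proof -
    obtain c where "c > 0" "hoggatt 1 (Suc e) = smult c (smult (1 / fact e) ([:1, 1:] ^ e))"
      using hoggatt_conv_poly[of 1 e] unfolding conv_poly_inv_fact by auto
    then show ?thesis by (intro exI[of _ "c / fact e"]) simp
  qed
  have rr: "real_rooted (hoggatt 1 (Suc e))" for e
  proof -
    obtain c where "c > 0" "hoggatt 1 (Suc e) = smult c ([:1, 1:] ^ e)" using hog by blast
    then show ?thesis
      using real_rooted_prod_mset[of c "replicate_mset e (- 1)"] by simp
  qed
  have deg: "degree (hoggatt 1 (Suc e)) = e" and nz: "hoggatt 1 (Suc e) \<noteq> 0" for e
    using hog[of e] by (auto simp: degree_power_eq)
  have zeros: "zeros_desc (hoggatt 1 (Suc e)) ! i = - 1" if "i < e" for e i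
  proof -
    obtain c where c: "c > 0" "hoggatt 1 (Suc e) = smult c ([:1, 1:] ^ e)" using hog by blast
    have proots: "proots (hoggatt 1 (Suc e)) = replicate_mset e (- 1)"
      unfolding c(2) using c(1) by (simp add: proots_power)
    have "mset (zeros_desc (hoggatt 1 (Suc e))) = replicate_mset e (- 1)"
      unfolding zeros_desc_def proots by simp
    then have "zeros_desc (hoggatt 1 (Suc e)) = replicate e (- 1)"
      by (metis mset_replicate replicate_length_same set_mset_mset size_mset in_replicate_mset size_replicate_mset)
    then show ?thesis using that by simp
  qed
  show ?thesis
    unfolding interlaces_wrt_def deg using rr nz zeros by simp
qed

theorem theorem1p2:
  shows "generalized_sturm_sequence {1..} (\<lambda>n. hoggatt 1 n) \<and>
         (\<forall>m\<ge>2. sturm_sequence {1..} (\<lambda>n. hoggatt m n))"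
proof (intro conjI allI impI)
  have Suc: "\<exists>d. n = Suc d" if "n \<in> {1..}" for n :: nat
    using that by (cases n) auto
  show "generalized_sturm_sequence {1..} (\<lambda>n. hoggatt 1 n)"
    \<comment> \<open>Real-rootedness of each member is contained in the interlacing statement for
      the pair that it begins.\<close>
    unfolding generalized_sturm_sequence_def poly_preceq_def
    using Suc interlaces_hoggatt_1 by (metis interlaces_wrt_def)
  show "sturm_sequence {1..} (\<lambda>n. hoggatt m n)" if "m \<ge> 2" for m
    unfolding sturm_sequence_def poly_prec_def
    using Suc strictly_interlaces_hoggatt[OF that] by (metis interlaces_wrt_def)
qed

end
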